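(* Let ${\bf s}=(W,v_1,\ldots,v_n)$ be an LG seed and $i\in\{1,\ldots,n\}$. Then the comparison map is compatible with mutation, that is, $$\mu_i^C\circ\Phi_{\bf s}=\Phi_{\mu_i{\bf s}}\circ\mu_i^S$$ as maps from $\mathbb{C}[z_1^\pm,z_2^\pm]$ to $\mathbb{C}(x_1,\ldots,x_n)$, where $\mu_i^S=\mu_{v_i}$ is the mutation of rational functions in $z_1,z_2$ in direction $v_i$, and $\mu_i^C$ is the cluster mutation of $x$-variables at $i$ with respect to the matrix $B({\bf s})$.
   Context: $[a]_+=\max(a,0)$. For $v=(a,b),w=(c,d)\in\mathbb{Z}^2$: $v^\perp=(b,-a)$, $(v,w)=ac+bd$, $\{v,w\}=ad-bc$, $z^w=z_1^cz_2^d$. For a primitive vector $v\in\mathbb{Z}^2$, $\mu_v$ is the automorphism of $\mathbb{C}(z_1,z_2)$ determined by $\mu_v(z^w)=z^w(1+z^{v^\perp})^{-(v,w)}$; on vectors, $\mu_vw=w+[\{w,v\}]_+v$. A seed ${\bf s}=(W,v_1,\ldots,v_n)$ consists of a Laurent polynomial $W\in\mathbb{C}[z_1^\pm,z_2^\pm]$ and pairwise different primitive vectors $v_1,\ldots,v_n\in\mathbb{Z}^2$. It is an LG (Landau–Ginzburg) seed if $\mu_{v_i}W$ is a Laurent polynomial for all $i$. Then $\mu_i{\bf s}=(\mu_{v_i}W,v_1',\ldots,v_n')$ with $v_i'=-v_i$ and $v_j'=\mu_{v_i}v_j$ for $j\ne i$. $B({\bf s})=(b_{j,k})$ is the skew-symmetric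 matrix $b_{j,k}=\{v_j,v_k\}$. The cluster mutation $\mu_i^C$ is the automorphism of $\mathbb{C}(x_1,\ldots,x_n)$ with $\mu_i^C(x_j)=x_j$ for $j\neq i$ and $\mu_i^C(x_i)=x_i^{-1}\prod_jx_j^{[b_{i,j}]_+}\bigl(1+\prod_jx_j^{-b_{i,j}}\bigr)$. The comparison map of a seed with directions $v_1,\ldots,v_n$ is the algebra homomorphism $\Phi_{\bf s}:\mathbb{C}[z_1^\pm,z_2^\pm]\to\mathbb{C}[x_1^\pm,\ldots,x_n^\pm]$, $\Phi_{\bf s}(z^v)=\prod_jx_j^{-(v,v_j)}$. On the right-hand side of the claim, $\Phi_{\mu_i{\bf s}}$ (formed with $v_1',\ldots,v_n'$) is extended to the localization of $\mathbb{C}[z_1^\pm,z_2^\pm]$ at $1+z^{v_i^\perp}$, with values in $\mathbb{C}(x_1,\ldots,x_n)$. *)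

theory Defs
  imports Complex_Main "HOL-Library.Poly_Mapping" "HOL-Library.Numeral_Type"
    "HOL-Computational_Algebra.Polynomial_Factorial"
begin

section \<open>Laurent polynomials and rational functions\<close>

text \<open>
  The Laurent polynomial ring over the complex numbers with variables indexed by a finite type
  is the group algebra of the lattice of exponent vectors, and the field of rational functions
  is its field of fractions. The linear order on the index type in the definitions below is only
  there because the library proves that the group algebra is an integral domain by means of it;
  the order itself plays no role.
\<close>

type_synonym 'n laurent = "('n \<Rightarrow>\<^sub>0 int) \<Rightarrow>\<^sub>0 complex"

type_synonym 'n ratfun = "'n laurent fract"

definition lconst :: "complex \<Rightarrow> 'n laurent" where
  "lconst c = Poly_Mapping.single 0 c"

definition lmonom :: "('n::finite \<Rightarrow> int) \<Rightarrow> 'n laurent" where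
  "lmonom m = Poly_Mapping.single (\<Sum>j\<in>UNIV. Poly_Mapping.single j (m j)) 1"

definition ratvar :: "'n::{finite,linorder} \<Rightarrow> 'n ratfun" where
  "ratvar i = to_fract (lmonom (\<lambda>j. if j = i then 1 else 0))"

definition ratfun_automorphism :: "('n::{finite,linorder} ratfun \<Rightarrow> 'n ratfun) \<Rightarrow> bool" where
  "ratfun_automorphism \<phi> \<longleftrightarrow> bij \<phi> \<and>
     (\<forall>f g. \<phi> (f + g) = \<phi> f + \<phi> g) \<and> (\<forall>f g. \<phi> (f * g) = \<phi> f * \<phi> g) \<and>
     (\<forall>c. \<phi> (to_fract (lconst c)) = to_fract (lconst c))"


section \<open>Plane vectors\<close>

type_synonym vec = "int \<times> int"

definition perp :: "vec \<Rightarrow> vec" where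
  "perp v = (snd v, - fst v)"

definition dot :: "vec \<Rightarrow> vec \<Rightarrow> int" where
  "dot v w = fst v * fst w + snd v * snd w"

definition bracket :: "vec \<Rightarrow> vec \<Rightarrow> int" where
  "bracket v w = fst v * snd w - snd v * fst w"

definition pos_part :: "int \<Rightarrow> int" where
  "pos_part a = max a 0"

definition primitive_vec :: "vec \<Rightarrow> bool" where
  "primitive_vec v \<longleftrightarrow> coprime (fst v) (snd v)"

text \<open>
  The variables \<open>z\<^sub>1\<close>, \<open>z\<^sub>2\<close> carry the indices \<open>0\<close>, \<open>1\<close> of the two-element type \<open>2\<close>.
\<close>

definition zmonom :: "vec \<Rightarrow> 2 laurent" where
  "zmonom w = lmonom (\<lambda>k. if k = 0 then fst w else snd w)"


section \<open>Mutation in direction of a vector\<close>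

definition mut_vec :: "vec \<Rightarrow> vec \<Rightarrow> vec" where
  "mut_vec v w = (fst w + pos_part (bracket w v) * fst v, snd w + pos_part (bracket w v) * snd v)"

definition mut_ratfun :: "vec \<Rightarrow> 2 ratfun \<Rightarrow> 2 ratfun" where
  "mut_ratfun v = (THE \<phi>. ratfun_automorphism \<phi> \<and>
     (\<forall>w. \<phi> (to_fract (zmonom w)) =
        to_fract (zmonom w) * (1 + to_fract (zmonom (perp v))) powi (- dot v w)))"


section \<open>Seeds\<close>

datatype 'n seed = Seed (potential: "2 laurent") (directions: "'n \<Rightarrow> vec")

definition is_seed :: "'n seed \<Rightarrow> bool" where
  "is_seed s \<longleftrightarrow> (\<forall>i. primitive_vec (directions s i)) \<and> inj (directions s)"

definition LG_seed :: "'n seed \<Rightarrow> bool" where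
  "LG_seed s \<longleftrightarrow> is_seed s \<and>
     (\<forall>i. mut_ratfun (directions s i) (to_fract (potential s)) \<in> range to_fract)"

definition mutate_seed :: "'n \<Rightarrow> 'n seed \<Rightarrow> 'n seed" where
  "mutate_seed i s = Seed
     (THE W'. to_fract W' = mut_ratfun (directions s i) (to_fract (potential s)))
     (\<lambda>j. if j = i then (- fst (directions s i), - snd (directions s i))
          else mut_vec (directions s i) (directions s j))"

definition exchange_matrix :: "'n seed \<Rightarrow> 'n \<Rightarrow> 'n \<Rightarrow> int" where
  "exchange_matrix s j k = bracket (directions s j) (directions s k)"


section \<open>Cluster mutation\<close>

definition cluster_mutation ::
  "('n \<Rightarrow> 'n \<Rightarrow> int) \<Rightarrow> 'n \<Rightarrow> 'n::{finite,linorder} ratfun \<Rightarrow> 'n ratfun" where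
  "cluster_mutation B i = (THE \<phi>. ratfun_automorphism \<phi> \<and>
     (\<forall>j. j \<noteq> i \<longrightarrow> \<phi> (ratvar j) = ratvar j) \<and>
     \<phi> (ratvar i) = inverse (ratvar i) * (\<Prod>j\<in>UNIV. ratvar j powi pos_part (B i j)) *
       (1 + (\<Prod>j\<in>UNIV. ratvar j powi (- B i j))))"


section \<open>The comparison map\<close>

text \<open>
  The complex-linear map sending \<open>z\<^sup>w\<close> to the monomial with exponents \<open>- dot w (directions s j)\<close>.
\<close>

definition comparison_map :: "'n::finite seed \<Rightarrow> 2 laurent \<Rightarrow> 'n laurent" where
  "comparison_map s f = (\<Sum>m\<in>Poly_Mapping.keys f. lconst (Poly_Mapping.lookup f m) *
     lmonom (\<lambda>j. - dot (Poly_Mapping.lookup m 0, Poly_Mapping.lookup m 1) (directions s j)))"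

text \<open>
  The extension to the localization at the powers of \<open>d\<close>, as a subring of the rational functions.
  It is meaningful if the comparison map does not send \<open>d\<close> to \<open>0\<close>, and outside of the localization
  it has no specified value.
\<close>

definition comparison_map_loc ::
  "'n::{finite,linorder} seed \<Rightarrow> 2 laurent \<Rightarrow> 2 ratfun \<Rightarrow> 'n ratfun" where
  "comparison_map_loc s d F = (THE y. \<exists>p k. F = to_fract p / to_fract d ^ k \<and>
     y = to_fract (comparison_map s p) / to_fract (comparison_map s d) ^ k)"

end

theory Submission
  imports Defs
begin

text \<open>
  Both sides of the claim are algebra homomorphisms on the Laurent polynomials, so they only have
  to be compared on the monomials \<open>z\<^sup>w\<close>. Write \<open>v\<close> for the direction of mutation, \<open>b\<^sub>j\<close> for the
  entries of row \<open>i\<close> of the exchange matrix and \<open>x\<^sup>b\<close> for the product of the \<open>x\<^sub>j\<close> to the \<open>b\<^sub>j\<close>. The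
  cluster mutation sends \<open>x\<^sub>i\<close> to \<open>x\<^sub>i\<close> inverse times the exchange binomial

    \<open>x\<^bsup>[b]+\<^esup> (1 + x\<^bsup>-b\<^esup>) = x\<^bsup>[b]+\<^esup> + x\<^bsup>[-b]+\<^esup> = x\<^bsup>[-b]+\<^esup> (1 + x\<^sup>b)\<close>.

  In the form on the right, the factor \<open>1 + x\<^sup>b\<close> is the image of \<open>1 + z\<^bsup>perp v\<^esup>\<close> under the comparison
  map of the mutated seed, and the monomial in front of it accounts for the change of
  directions \<open>v\<^sub>j \<mapsto> v\<^sub>j + [-b\<^sub>j]\<^sub>+ v\<close>. This is the comparison on monomials,
  \<open>cluster_mutation_comparison_map_zmonom\<close>.

  The remaining work is to give a meaning to the two mutations and to the localized comparison map,
  which are defined by their characteristic properties. Both mutations have the same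
  shape: \<open>z\<^sup>m\<close> goes to \<open>z\<^bsup>A m\<^esup> u\<^bsup>\<nu> m\<^esup>\<close> where \<open>A\<close> is a linear involution of the lattice of exponents, \<open>\<nu>\<close>
  is a linear form, and \<open>u\<close> is a binomial fixed by the substitution. That these substitutions are
  automorphisms of the field of rational functions is \<open>twist_automorphism\<close>. Its crux, and also the
  means to pass through the localization without constructing it, is the clearing of denominators in
  \<open>common_numerator\<close>.
\<close>

section \<open>Laurent monomials\<close>

lemma lookup_sum_single [simp]:
  "Poly_Mapping.lookup (\<Sum>j\<in>(UNIV::'n::finite set). Poly_Mapping.single j (m j :: int)) = m"
  by (simp add: fun_eq_iff lookup_sum lookup_single when_def)

lemma sum_single_lookup [simp]:
  "(\<Sum>j\<in>(UNIV::'n::finite set). Poly_Mapping.single j (Poly_Mapping.lookup e j :: int)) = e"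
  by (rule poly_mapping_eqI) simp

lemma lmonom_0 [simp]: "lmonom (\<lambda>_. 0) = 1"
  by (simp add: lmonom_def)

lemma lmonom_add: "lmonom (\<lambda>j. a j + b j) = lmonom a * lmonom b"
  by (simp add: lmonom_def mult_single single_add sum.distrib)

lemma keys_lmonom [simp]:
  "Poly_Mapping.keys (lmonom m) = {\<Sum>j\<in>UNIV. Poly_Mapping.single j (m j)}"
  by (simp add: lmonom_def)

lemma lmonom_nonzero [simp]: "lmonom m \<noteq> 0"
  using keys_lmonom[of m] by (metis insert_not_empty keys_zero)

lemma lconst_0 [simp]: "lconst 0 = 0" and lconst_1 [simp]: "lconst 1 = 1"
  by (simp_all add: lconst_def)

lemma lconst_mult: "lconst (c * d) = lconst c * lconst d"
  by (simp add: lconst_def mult_single)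

lemma single_eq_lconst_mult_lmonom:
  "Poly_Mapping.single e c = lconst c * lmonom (Poly_Mapping.lookup e)"
  by (simp add: lconst_def lmonom_def mult_single)

text \<open>The sum of two equal monomials is twice a monomial, hence nonzero over the complex numbers.\<close>
lemma lmonom_add_lmonom_nonzero: "lmonom a + lmonom b \<noteq> 0"
proof
  let ?e = "\<lambda>m. \<Sum>j\<in>UNIV. Poly_Mapping.single j (m j :: int)"
  assume "lmonom a + lmonom b = 0"
  then have "Poly_Mapping.lookup (lmonom a + lmonom b) (?e a) = 0" by simp
  then show False
    by (auto simp: lmonom_def lookup_add lookup_single when_def split: if_splits)
qed

lemma laurent_induct [case_names zero add monomial]:
  fixes f :: "'n::finite laurent"
  assumes "P 0" and "\<And>f g. P f \<Longrightarrow> P g \<Longrightarrow> P (f + g)"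
    and "\<And>c m. P (lconst c * lmonom m)"
  shows "P f"
proof (induction f rule: update_induct)
  case const
  show ?case by (fact assms(1))
next
  case (update f e c)
  have "Poly_Mapping.update e c f = f + Poly_Mapping.single e c"
    using update(1)
    by (intro poly_mapping_eqI)
      (auto simp: lookup_update lookup_add lookup_single when_def in_keys_iff)
  then show ?case
    using assms(2)[OF update(3) assms(3)[of c "Poly_Mapping.lookup e"]]
    by (simp add: single_eq_lconst_mult_lmonom)
qed


section \<open>Homomorphisms into fields of rational functions\<close>

definition laurent_hom :: "('n::finite laurent \<Rightarrow> 'm::{finite,linorder} ratfun) \<Rightarrow> bool" where
  "laurent_hom \<phi> \<longleftrightarrow> (\<forall>f g. \<phi> (f + g) = \<phi> f + \<phi> g) \<and>
     (\<forall>f g. \<phi> (f * g) = \<phi> f * \<phi> g) \<and> (\<forall>c. \<phi> (lconst c) = to_fract (lconst c))"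

context
  fixes \<phi> :: "'n::finite laurent \<Rightarrow> 'm::{finite,linorder} ratfun"
  assumes hom: "laurent_hom \<phi>"
begin

lemma laurent_hom_add: "\<phi> (f + g) = \<phi> f + \<phi> g"
  and laurent_hom_mult: "\<phi> (f * g) = \<phi> f * \<phi> g"
  and laurent_hom_lconst: "\<phi> (lconst c) = to_fract (lconst c)"
  using hom by (auto simp: laurent_hom_def)

lemma laurent_hom_0: "\<phi> 0 = 0"
  using laurent_hom_lconst[of 0] by simp

lemma laurent_hom_1: "\<phi> 1 = 1"
  using laurent_hom_lconst[of 1] by simp

lemma laurent_hom_power: "\<phi> (f ^ k) = \<phi> f ^ k"
  by (induction k) (simp_all add: laurent_hom_1 laurent_hom_mult)

end

lemmas laurent_hom_simps = laurent_hom_add laurent_hom_mult laurent_hom_lconst laurent_hom_0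
  laurent_hom_1 laurent_hom_power

lemma laurent_hom_to_fract: "laurent_hom to_fract"
  by (simp add: laurent_hom_def)

lemma laurent_hom_eqI:
  assumes "laurent_hom \<phi>" "laurent_hom \<psi>" "\<And>m. \<phi> (lmonom m) = \<psi> (lmonom m)"
  shows "\<phi> = \<psi>"
proof
  fix f
  show "\<phi> f = \<psi> f"
    using assms(3)
    by (induction f rule: laurent_induct)
      (simp_all add: laurent_hom_simps[OF assms(1)] laurent_hom_simps[OF assms(2)])
qed

definition monomial_lift ::
  "(('n::finite \<Rightarrow> int) \<Rightarrow> 'm::{finite,linorder} ratfun) \<Rightarrow> 'n laurent \<Rightarrow> 'm ratfun" where
  "monomial_lift M f = (\<Sum>e\<in>Poly_Mapping.keys f.
     to_fract (lconst (Poly_Mapping.lookup f e)) * M (Poly_Mapping.lookup e))"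

text \<open>
  The universal property of the group algebra of \<open>\<int>\<^sup>n\<close>: a character of the lattice of exponents
  extends to an algebra homomorphism.
\<close>
lemma
  fixes M :: "('n::finite \<Rightarrow> int) \<Rightarrow> 'm::{finite,linorder} ratfun"
  assumes M0: "M (\<lambda>_. 0) = 1" and M_add: "\<And>a b. M (\<lambda>j. a j + b j) = M a * M b"
  shows laurent_hom_monomial_lift: "laurent_hom (monomial_lift M)"
    and monomial_lift_lmonom: "monomial_lift M (lmonom m) = M m"
proof -
  have superset: "monomial_lift M f = (\<Sum>e\<in>S. to_fract (lconst (Poly_Mapping.lookup f e)) *
      M (Poly_Mapping.lookup e))" if "finite S" "Poly_Mapping.keys f \<subseteq> S" for f S
    unfolding monomial_lift_def
    by (rule sum.mono_neutral_left) (use that in \<open>auto simp: in_keys_iff\<close>)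
  have add: "monomial_lift M (f + g) = monomial_lift M f + monomial_lift M g" for f g
  proof -
    let ?S = "Poly_Mapping.keys f \<union> Poly_Mapping.keys g"
    have "Poly_Mapping.keys (f + g) \<subseteq> ?S" by (rule keys_add)
    then show ?thesis
      by (simp add: superset[of ?S] lookup_add lconst_def single_add distrib_right sum.distrib)
  qed
  have single: "monomial_lift M (Poly_Mapping.single e c) =
      to_fract (lconst c) * M (Poly_Mapping.lookup e)" for e c
    by (simp add: superset[of "{e}"])
  have zero: "monomial_lift M 0 = 0"
    by (simp add: monomial_lift_def)
  have lmonom_term: "monomial_lift M (lconst c * lmonom m) = to_fract (lconst c) * M m" for c m
    using single[of "\<Sum>j\<in>UNIV. Poly_Mapping.single j (m j)" c]
    by (simp add: single_eq_lconst_mult_lmonom)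
  show "monomial_lift M (lmonom m) = M m" for m
    using lmonom_term[of 1] by simp
  have mult_term: "monomial_lift M ((lconst c * lmonom a) * (lconst d * lmonom b)) =
      monomial_lift M (lconst c * lmonom a) * monomial_lift M (lconst d * lmonom b)" for a b c d
  proof -
    have "(lconst c * lmonom a) * (lconst d * lmonom b) =
        lconst (c * d) * lmonom (\<lambda>j. a j + b j)"
      by (simp add: lmonom_add lconst_mult mult_ac)
    then show ?thesis
      by (simp only: lmonom_term) (simp add: M_add lconst_mult mult_ac)
  qed
  have mult_left: "monomial_lift M ((lconst c * lmonom a) * g) =
      monomial_lift M (lconst c * lmonom a) * monomial_lift M g" for a c g
    by (induction g rule: laurent_induct) (simp_all add: zero add distrib_left mult_term)
  have mult: "monomial_lift M (f * g) = monomial_lift M f * monomial_lift M g" for f g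
    by (induction f rule: laurent_induct) (simp_all add: zero add distrib_right mult_left)
  have const: "monomial_lift M (lconst c) = to_fract (lconst c)" for c
    using lmonom_term[of c "\<lambda>_. 0"] by (simp add: M0)
  show "laurent_hom (monomial_lift M)"
    using add mult const by (simp add: laurent_hom_def)
qed

text \<open>
  Denominators can be cleared by a single power of \<open>d\<close>, simultaneously on two sides. If \<open>\<psi>\<close> maps
  monomials into the localization at \<open>\<iota> d\<close>, then all values of \<open>\<psi>\<close> lie there, and a fraction
  \<open>p / d ^ k\<close> that represents a value of \<open>\<psi>\<close> through \<open>\<iota>\<close> can be chosen to represent the value of
  \<open>\<chi>\<close> through \<open>\<phi>\<close>. This says that \<open>\<chi>\<close> is the composition of \<open>\<psi>\<close> with the extension of \<open>\<phi>\<close> to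
  the localization at \<open>d\<close>, without mentioning that extension. A power of \<open>d\<close> that works for two
  polynomials works for their sum, so the question reduces to monomials.
\<close>
lemma common_numerator:
  fixes \<iota> :: "'b::finite laurent \<Rightarrow> 'c::{finite,linorder} ratfun"
    and \<phi> :: "'b laurent \<Rightarrow> 'd::{finite,linorder} ratfun"
    and \<psi> :: "'a::finite laurent \<Rightarrow> 'c ratfun" and \<chi> :: "'a laurent \<Rightarrow> 'd ratfun"
  assumes \<iota>: "laurent_hom \<iota>" and \<phi>: "laurent_hom \<phi>" and \<psi>: "laurent_hom \<psi>" and \<chi>: "laurent_hom \<chi>"
    and nz: "\<iota> d \<noteq> 0" "\<phi> d \<noteq> 0"
    and monom: "\<And>m. \<exists>q l. \<psi> (lmonom m) = \<iota> q * \<iota> d powi l \<and> \<chi> (lmonom m) = \<phi> q * \<phi> d powi l"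
  obtains p k where "\<psi> f * \<iota> d ^ k = \<iota> p" "\<chi> f * \<phi> d ^ k = \<phi> p"
proof -
  have "\<exists>p k. \<psi> f * \<iota> d ^ k = \<iota> p \<and> \<chi> f * \<phi> d ^ k = \<phi> p"
  proof (induction f rule: laurent_induct)
    case zero
    have "\<psi> 0 * \<iota> d ^ 0 = \<iota> 0 \<and> \<chi> 0 * \<phi> d ^ 0 = \<phi> 0"
      by (simp add: laurent_hom_0 \<iota> \<phi> \<psi> \<chi>)
    then show ?case by blast
  next
    case (add f g)
    obtain p k q l where f: "\<psi> f * \<iota> d ^ k = \<iota> p" "\<chi> f * \<phi> d ^ k = \<phi> p"
      and g: "\<psi> g * \<iota> d ^ l = \<iota> q" "\<chi> g * \<phi> d ^ l = \<phi> q"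
      using add by blast
    have "\<psi> (f + g) * \<iota> d ^ (k + l) = \<iota> (p * d ^ l + q * d ^ k)"
      by (simp add: laurent_hom_simps[OF \<iota>] laurent_hom_simps[OF \<psi>] flip: f g)
        (simp add: power_add algebra_simps)
    moreover have "\<chi> (f + g) * \<phi> d ^ (k + l) = \<phi> (p * d ^ l + q * d ^ k)"
      by (simp add: laurent_hom_simps[OF \<phi>] laurent_hom_simps[OF \<chi>] flip: f g)
        (simp add: power_add algebra_simps)
    ultimately show ?case by blast
  next
    case (monomial c m)
    obtain q l where q: "\<psi> (lmonom m) = \<iota> q * \<iota> d powi l" "\<chi> (lmonom m) = \<phi> q * \<phi> d powi l"
      using monom by blast
    \<comment> \<open>The factor with exponent \<open>nat \<bar>l\<bar>\<close> makes the exponent nonnegative for either sign of \<open>l\<close>.\<close>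
    have clear: "x powi l * x ^ nat \<bar>l\<bar> = x ^ nat (l + \<bar>l\<bar>)" if "x \<noteq> 0" for x :: "'e::field"
    proof -
      have "x powi l * x ^ nat \<bar>l\<bar> = x powi (l + \<bar>l\<bar>)"
        using that power_int_nonneg_exp[of "\<bar>l\<bar>" x] by (simp add: power_int_add)
      also have "\<dots> = x ^ nat (l + \<bar>l\<bar>)"
        by (rule power_int_nonneg_exp) simp
      finally show ?thesis .
    qed
    have "\<psi> (lconst c * lmonom m) * \<iota> d ^ nat \<bar>l\<bar> = \<iota> (lconst c * q * d ^ nat (l + \<bar>l\<bar>))"
      by (simp add: laurent_hom_simps[OF \<iota>] laurent_hom_simps[OF \<psi>] q mult.assoc clear nz)
    moreover have "\<chi> (lconst c * lmonom m) * \<phi> d ^ nat \<bar>l\<bar> = \<phi> (lconst c * q * d ^ nat (l + \<bar>l\<bar>))"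
      by (simp add: laurent_hom_simps[OF \<phi>] laurent_hom_simps[OF \<chi>] q mult.assoc clear nz)
    ultimately show ?case by blast
  qed
  then show ?thesis using that by blast
qed


section \<open>Endomorphisms of the field of rational functions\<close>

definition ratfun_endomorphism :: "('n::{finite,linorder} ratfun \<Rightarrow> 'n ratfun) \<Rightarrow> bool" where
  "ratfun_endomorphism \<phi> \<longleftrightarrow> (\<forall>f g. \<phi> (f + g) = \<phi> f + \<phi> g) \<and> (\<forall>f g. \<phi> (f * g) = \<phi> f * \<phi> g) \<and>
     (\<forall>c. \<phi> (to_fract (lconst c)) = to_fract (lconst c))"

lemma ratfun_automorphism_iff:
  "ratfun_automorphism \<phi> \<longleftrightarrow> bij \<phi> \<and> ratfun_endomorphism \<phi>"
  by (simp add: ratfun_automorphism_def ratfun_endomorphism_def)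

context
  fixes \<phi> :: "'n::{finite,linorder} ratfun \<Rightarrow> 'n ratfun"
  assumes endo: "ratfun_endomorphism \<phi>"
begin

lemma ratfun_endomorphism_add: "\<phi> (f + g) = \<phi> f + \<phi> g"
  and ratfun_endomorphism_mult: "\<phi> (f * g) = \<phi> f * \<phi> g"
  and ratfun_endomorphism_lconst: "\<phi> (to_fract (lconst c)) = to_fract (lconst c)"
  using endo by (auto simp: ratfun_endomorphism_def)

lemma ratfun_endomorphism_0: "\<phi> 0 = 0"
  using ratfun_endomorphism_lconst[of 0] by simp

lemma ratfun_endomorphism_1: "\<phi> 1 = 1"
  using ratfun_endomorphism_lconst[of 1] by simp

lemma ratfun_endomorphism_inverse: "\<phi> (inverse f) = inverse (\<phi> f)"
proof (cases "f = 0")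
  case False
  then have "\<phi> f * \<phi> (inverse f) = 1"
    by (simp add: ratfun_endomorphism_1 flip: ratfun_endomorphism_mult)
  then show ?thesis by (simp add: inverse_unique)
qed (simp add: ratfun_endomorphism_0)

lemma ratfun_endomorphism_divide: "\<phi> (f / g) = \<phi> f / \<phi> g"
  by (simp add: divide_inverse ratfun_endomorphism_mult ratfun_endomorphism_inverse)

lemma ratfun_endomorphism_power: "\<phi> (f ^ k) = \<phi> f ^ k"
  by (induction k) (simp_all add: ratfun_endomorphism_1 ratfun_endomorphism_mult)

lemma ratfun_endomorphism_powi: "\<phi> (f powi k) = \<phi> f powi k"
  by (simp add: power_int_def ratfun_endomorphism_power ratfun_endomorphism_inverse)

lemma ratfun_endomorphism_prod: "\<phi> (\<Prod>j\<in>A. g j) = (\<Prod>j\<in>A. \<phi> (g j))"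
  by (induction A rule: infinite_finite_induct)
    (simp_all add: ratfun_endomorphism_1 ratfun_endomorphism_mult)

lemma laurent_hom_endomorphism_comp: "laurent_hom h \<Longrightarrow> laurent_hom (\<lambda>f. \<phi> (h f))"
  by (simp add: laurent_hom_def ratfun_endomorphism_add ratfun_endomorphism_mult
      ratfun_endomorphism_lconst)

end

lemma ratfun_endomorphism_eqI:
  fixes \<phi> \<psi> :: "'n::{finite,linorder} ratfun \<Rightarrow> 'n ratfun"
  assumes "ratfun_endomorphism \<phi>" "ratfun_endomorphism \<psi>"
    and "\<And>m. \<phi> (to_fract (lmonom m)) = \<psi> (to_fract (lmonom m))"
  shows "\<phi> = \<psi>"
proof
  fix F :: "'n ratfun"
  have eq: "(\<lambda>f. \<phi> (to_fract f)) = (\<lambda>f. \<psi> (to_fract f))"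
    by (rule laurent_hom_eqI)
      (use assms laurent_hom_endomorphism_comp laurent_hom_to_fract in blast)+
  obtain a b where "F = to_fract a / to_fract b"
    by (cases F) (auto simp: Fract_conv_to_fract)
  then show "\<phi> F = \<psi> F"
    using fun_cong[OF eq] assms by (simp add: ratfun_endomorphism_divide)
qed

text \<open>
  The universal property of the field of fractions. The choice of a representing pair is harmless
  because injectivity of \<open>\<psi>\<close> makes the quotient of the images independent of it.
\<close>
lemma laurent_hom_extends_to_ratfun:
  fixes \<psi> :: "'n::{finite,linorder} laurent \<Rightarrow> 'n ratfun"
  assumes \<psi>: "laurent_hom \<psi>" and inj: "\<And>f. \<psi> f = 0 \<Longrightarrow> f = 0"
  obtains \<Psi> where "ratfun_endomorphism \<Psi>" "\<And>f. \<Psi> (to_fract f) = \<psi> f"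
proof -
  define \<Psi> where "\<Psi> F = (let (a, b) = SOME (a, b). b \<noteq> 0 \<and> F = to_fract a / to_fract b in \<psi> a / \<psi> b)"
    for F
  have frac: "\<Psi> (to_fract a / to_fract b) = \<psi> a / \<psi> b" if "b \<noteq> 0" for a b
  proof -
    obtain a' b' where ab: "(SOME (a', b'). b' \<noteq> 0 \<and>
        to_fract a / to_fract b = to_fract a' / to_fract b') = (a', b')"
      by fastforce
    have "b' \<noteq> 0 \<and> to_fract a / to_fract b = to_fract a' / to_fract b'"
      using someI[of "\<lambda>(a', b'). b' \<noteq> 0 \<and> to_fract a / to_fract b = to_fract a' / to_fract b'"
          "(a, b)"] that unfolding ab by simp
    then have "b' \<noteq> 0" "a * b' = a' * b"
      using that by (auto simp: frac_eq_eq simp flip: to_fract_mult)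
    then have "\<psi> a * \<psi> b' = \<psi> a' * \<psi> b" "\<psi> b' \<noteq> 0" "\<psi> b \<noteq> 0"
      using inj that by (auto simp flip: laurent_hom_mult[OF \<psi>])
    then show ?thesis
      unfolding \<Psi>_def ab by (simp add: frac_eq_eq)
  qed
  have of_laurent: "\<Psi> (to_fract f) = \<psi> f" for f
    using frac[of 1 f] by (simp add: laurent_hom_1[OF \<psi>])
  have "\<Psi> (F + G) = \<Psi> F + \<Psi> G \<and> \<Psi> (F * G) = \<Psi> F * \<Psi> G" for F G
  proof -
    obtain a b c d where F: "F = to_fract a / to_fract b" "b \<noteq> 0"
      and G: "G = to_fract c / to_fract d" "d \<noteq> 0"
      by (cases F, cases G) (auto simp: Fract_conv_to_fract)
    have nz: "\<psi> b \<noteq> 0" "\<psi> d \<noteq> 0" using inj F G by auto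
    have "F + G = to_fract (a * d + c * b) / to_fract (b * d)"
      "F * G = to_fract (a * c) / to_fract (b * d)"
      using F G by (simp_all add: field_simps)
    moreover have "b * d \<noteq> 0" using F G by simp
    ultimately have "\<Psi> (F + G) = \<psi> (a * d + c * b) / \<psi> (b * d)"
      "\<Psi> (F * G) = \<psi> (a * c) / \<psi> (b * d)"
      by (metis frac)+
    then show ?thesis
      using F G nz by (simp add: frac laurent_hom_simps[OF \<psi>] add_frac_eq)
  qed
  then have "ratfun_endomorphism \<Psi>"
    by (simp add: ratfun_endomorphism_def of_laurent laurent_hom_lconst[OF \<psi>])
  then show ?thesis using of_laurent that by blast
qed


section \<open>Twisted monomial automorphisms\<close>

definition twisted_monomial ::
  "(('n \<Rightarrow> int) \<Rightarrow> ('n \<Rightarrow> int)) \<Rightarrow> 'n::{finite,linorder} laurent \<Rightarrow> (('n \<Rightarrow> int) \<Rightarrow> int) \<Rightarrow>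
    ('n \<Rightarrow> int) \<Rightarrow> 'n ratfun" where
  "twisted_monomial A u \<nu> m = to_fract (lmonom (A m)) * to_fract u powi \<nu> m"

text \<open>
  Both mutations are instances: for the mutation in direction \<open>v\<close>, \<open>A\<close> is the identity, \<open>\<nu>\<close> is
  \<open>- dot v\<close> and \<open>u\<close> is \<open>1 + z\<^bsup>perp v\<^esup>\<close>; for the cluster mutation, \<open>A\<close> changes the sign of the \<open>i\<close>-th
  exponent, \<open>\<nu>\<close> is the \<open>i\<close>-th exponent and \<open>u\<close> is the exchange binomial. The conditions on the
  exponents of \<open>u\<close> say that each of its terms is fixed by the substitution.
\<close>
locale monomial_twist =
  fixes A :: "('n::{finite,linorder} \<Rightarrow> int) \<Rightarrow> ('n \<Rightarrow> int)" and \<nu> :: "('n \<Rightarrow> int) \<Rightarrow> int"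
    and u :: "'n laurent"
  assumes A_add: "A (\<lambda>j. a j + b j) = (\<lambda>j. A a j + A b j)" and A_invol: "A (A m) = m"
    and \<nu>_add: "\<nu> (\<lambda>j. a j + b j) = \<nu> a + \<nu> b"
    and u_nonzero: "u \<noteq> 0"
    and A_u: "e \<in> Poly_Mapping.keys u \<Longrightarrow> A (Poly_Mapping.lookup e) = Poly_Mapping.lookup e"
    and \<nu>_u: "e \<in> Poly_Mapping.keys u \<Longrightarrow> \<nu> (Poly_Mapping.lookup e) = 0"
begin

lemma A_0: "A (\<lambda>_. 0) = (\<lambda>_. 0)"
  using A_add[of "\<lambda>_. 0" "\<lambda>_. 0"] by (simp add: fun_eq_iff)

lemma \<nu>_0: "\<nu> (\<lambda>_. 0) = 0"
  using \<nu>_add[of "\<lambda>_. 0" "\<lambda>_. 0"] by simp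

definition twist :: "'n laurent \<Rightarrow> 'n ratfun" where
  "twist = monomial_lift (twisted_monomial A u \<nu>)"

lemma laurent_hom_twist: "laurent_hom twist"
  and twist_lmonom: "twist (lmonom m) = twisted_monomial A u \<nu> m"
  unfolding twist_def
  by (rule laurent_hom_monomial_lift monomial_lift_lmonom;
      simp add: twisted_monomial_def A_0 \<nu>_0 A_add \<nu>_add lmonom_add power_int_add u_nonzero)+

lemma twist_u: "twist u = to_fract u"
proof -
  have "twist u = (\<Sum>e\<in>Poly_Mapping.keys u.
      to_fract (lconst (Poly_Mapping.lookup u e) * lmonom (Poly_Mapping.lookup e)))"
    by (simp add: twist_def monomial_lift_def twisted_monomial_def A_u \<nu>_u)
  also have "\<dots> = monomial_lift (\<lambda>m. to_fract (lmonom m)) u"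
    by (simp add: monomial_lift_def)
  also have "monomial_lift (\<lambda>m. to_fract (lmonom m)) = to_fract"
    by (rule laurent_hom_eqI)
      (simp_all add: laurent_hom_to_fract laurent_hom_monomial_lift monomial_lift_lmonom lmonom_add)
  finally show ?thesis .
qed

end

text \<open>
  The inverse of the substitution. As it fixes \<open>u\<close>, it sends \<open>z\<^bsup>A m\<^esup> u\<^bsup>\<nu> m\<^esup>\<close> to
  \<open>z\<^sup>m u\<^bsup>- \<nu> m\<^esup> u\<^bsup>\<nu> m\<^esup> = z\<^sup>m\<close>; it has the same shape with the same involution, so everything proved
  for a substitution applies to its inverse.
\<close>
lemma monomial_twist_inverse:
  "monomial_twist A \<nu> u \<Longrightarrow> monomial_twist A (\<lambda>m. - \<nu> (A m)) u"
  by (simp add: monomial_twist_def)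

text \<open>
  The inverse substitution undoes the substitution. As both take values in the field of fractions,
  they cannot be composed before they are known to be injective; clearing the denominator, a power
  of the fixed element \<open>u\<close>, makes the statement meaningful at this stage.
\<close>
lemma (in monomial_twist) inverse_twist_numerator:
  fixes f
  obtains p k where "twist f * to_fract u ^ k = to_fract p"
    "to_fract f * to_fract u ^ k = monomial_twist.twist A (\<lambda>m. - \<nu> (A m)) u p"
proof -
  interpret inv: monomial_twist A "\<lambda>m. - \<nu> (A m)" u
    by (rule monomial_twist_inverse) (rule monomial_twist_axioms)
  have nz: "to_fract u \<noteq> 0" using u_nonzero by simp
  have "\<exists>q l. twist (lmonom m) = to_fract q * to_fract u powi l \<and>
      to_fract (lmonom m) = inv.twist q * inv.twist u powi l" for m
  proof (intro exI conjI)
    show "twist (lmonom m) = to_fract (lmonom (A m)) * to_fract u powi \<nu> m"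
      by (simp add: twist_lmonom twisted_monomial_def)
    show "to_fract (lmonom m) = inv.twist (lmonom (A m)) * inv.twist u powi \<nu> m"
      using nz
      by (simp add: inv.twist_lmonom inv.twist_u twisted_monomial_def A_invol power_int_minus)
  qed
  moreover have "inv.twist u \<noteq> 0"
    using nz by (simp add: inv.twist_u)
  ultimately obtain p k where "twist f * to_fract u ^ k = to_fract p"
    "to_fract f * inv.twist u ^ k = inv.twist p"
    using common_numerator[OF laurent_hom_to_fract inv.laurent_hom_twist laurent_hom_twist
        laurent_hom_to_fract nz, where f = f] by blast
  then show ?thesis
    using that by (simp add: inv.twist_u)
qed

text \<open>
  The substitution is injective: if \<open>f\<close> goes to \<open>0\<close>, then the numerator \<open>p\<close> is \<open>0\<close>, and the inverse
  substitution recovers \<open>f u\<^sup>k\<close> from \<open>p\<close>.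
\<close>
lemma (in monomial_twist) twist_extends:
  obtains \<Psi> where "ratfun_endomorphism \<Psi>" "\<And>f. \<Psi> (to_fract f) = twist f"
proof -
  interpret inv: monomial_twist A "\<lambda>m. - \<nu> (A m)" u
    by (rule monomial_twist_inverse) (rule monomial_twist_axioms)
  have "f = 0" if "twist f = 0" for f
  proof -
    obtain p k where "twist f * to_fract u ^ k = to_fract p"
      "to_fract f * to_fract u ^ k = inv.twist p"
      by (rule inverse_twist_numerator)
    then show ?thesis
      using that u_nonzero by (simp add: laurent_hom_0[OF inv.laurent_hom_twist] eq_commute[of 0])
  qed
  then show ?thesis
    using laurent_hom_extends_to_ratfun[OF laurent_hom_twist] that by blast
qed

lemma (in monomial_twist) twist_automorphism:
  obtains \<Psi> where "ratfun_automorphism \<Psi>"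
    "\<And>m. \<Psi> (to_fract (lmonom m)) = twisted_monomial A u \<nu> m"
proof -
  interpret inv: monomial_twist A "\<lambda>m. - \<nu> (A m)" u
    by (rule monomial_twist_inverse) (rule monomial_twist_axioms)
  have invinv: "monomial_twist.twist A (\<lambda>m. - (- \<nu> (A (A m)))) u = twist"
    by (simp add: A_invol)
  obtain \<Psi> where \<Psi>: "ratfun_endomorphism \<Psi>" "\<And>f. \<Psi> (to_fract f) = twist f"
    using twist_extends by blast
  obtain \<Psi>' where \<Psi>': "ratfun_endomorphism \<Psi>'" "\<And>f. \<Psi>' (to_fract f) = inv.twist f"
    using inv.twist_extends by blast
  have nz: "to_fract u \<noteq> 0" using u_nonzero by simp
  have left: "\<Psi>' (twist f) = to_fract f" for f
  proof -
    obtain p k where "twist f * to_fract u ^ k = to_fract p"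
      and "to_fract f * to_fract u ^ k = inv.twist p"
      by (rule inverse_twist_numerator)
    then have "twist f = to_fract p / to_fract u ^ k" "to_fract f = inv.twist p / to_fract u ^ k"
      using nz by (simp_all add: field_simps)
    then show ?thesis
      by (simp add: ratfun_endomorphism_divide ratfun_endomorphism_power \<Psi>' inv.twist_u)
  qed
  have right: "\<Psi> (inv.twist f) = to_fract f" for f
  proof -
    obtain p k where "inv.twist f * to_fract u ^ k = to_fract p"
      and "to_fract f * to_fract u ^ k = twist p"
      by (rule inv.inverse_twist_numerator[unfolded invinv])
    then have "inv.twist f = to_fract p / to_fract u ^ k" "to_fract f = twist p / to_fract u ^ k"
      using nz by (simp_all add: field_simps)
    then show ?thesis
      by (simp add: ratfun_endomorphism_divide ratfun_endomorphism_power \<Psi> twist_u)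
  qed
  have fractions: "\<exists>a b. F = to_fract a / to_fract b" for F :: "'n ratfun"
    by (cases F) (auto simp: Fract_conv_to_fract)
  have "\<Psi>' (\<Psi> F) = F" "\<Psi> (\<Psi>' F) = F" for F
    using fractions[of F] by (auto simp: ratfun_endomorphism_divide \<Psi> \<Psi>' left right)
  then have "bij \<Psi>" by (intro o_bij[of \<Psi>']) (simp_all add: fun_eq_iff)
  then show ?thesis
    using \<Psi> that by (simp add: ratfun_automorphism_iff twist_lmonom)
qed


section \<open>The two mutations\<close>

lemma zmonom_eq_lmonom: "zmonom (m 0, m 1) = lmonom m"
proof -
  have "k = 0 \<or> k = 1" for k :: 2
  proof (cases k)
    case (of_int z)
    then have "z = 0 \<or> z = 1" by auto
    then show ?thesis using of_int by auto
  qed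
  then have "(if k = 0 then m 0 else m 1) = m k" for k :: 2
    by fastforce
  then show ?thesis by (simp only: zmonom_def fst_conv snd_conv)
qed

lemma keys_lmonom_add_lmonom:
  "e \<in> Poly_Mapping.keys (lmonom a + lmonom b) \<Longrightarrow>
    Poly_Mapping.lookup e = a \<or> Poly_Mapping.lookup e = b"
  using keys_add[of "lmonom a" "lmonom b"] by auto

lemma one_plus_zmonom_nonzero: "1 + zmonom w \<noteq> 0"
  using lmonom_add_lmonom_nonzero[of "\<lambda>_. 0"] by (simp only: lmonom_0 zmonom_def not_False_eq_True)

text \<open>
  The exponent of every term of \<open>1 + z\<^bsup>perp v\<^esup>\<close> is orthogonal to \<open>v\<close>, hence this binomial is fixed
  by the substitution, which is therefore an automorphism. It is the only one with the prescribed
  values, as an endomorphism is determined by its values on monomials.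
\<close>
lemma
  shows ratfun_automorphism_mut_ratfun: "ratfun_automorphism (mut_ratfun v)"
    and mut_ratfun_zmonom: "mut_ratfun v (to_fract (zmonom w)) =
      to_fract (zmonom w) * to_fract (1 + zmonom (perp v)) powi (- dot v w)"
proof -
  define P where "P \<phi> \<longleftrightarrow> ratfun_automorphism \<phi> \<and> (\<forall>w. \<phi> (to_fract (zmonom w)) =
      to_fract (zmonom w) * (1 + to_fract (zmonom (perp v))) powi (- dot v w))" for \<phi>
  interpret monomial_twist "\<lambda>m. m" "\<lambda>m::2 \<Rightarrow> int. - dot v (m 0, m 1)" "1 + zmonom (perp v)"
  proof
    fix e assume "e \<in> Poly_Mapping.keys (1 + zmonom (perp v))"
    then have "e \<in> Poly_Mapping.keys (lmonom (\<lambda>_. 0) + zmonom (perp v))"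
      by (simp only: lmonom_0)
    then show "- dot v (Poly_Mapping.lookup e 0, Poly_Mapping.lookup e 1) = 0"
      unfolding zmonom_def by (elim keys_lmonom_add_lmonom[THEN disjE]) (simp_all add: dot_def perp_def)
  qed (simp_all add: dot_def algebra_simps one_plus_zmonom_nonzero)
  obtain \<Psi> where \<Psi>: "ratfun_automorphism \<Psi>" "\<And>m. \<Psi> (to_fract (lmonom m)) =
      twisted_monomial (\<lambda>m. m) (1 + zmonom (perp v)) (\<lambda>m. - dot v (m 0, m 1)) m"
    using twist_automorphism by blast
  have "P \<Psi>"
    using \<Psi> by (simp add: P_def twisted_monomial_def zmonom_def)
  moreover have "\<phi> = \<Psi>" if "P \<phi>" for \<phi>
  proof (rule ratfun_endomorphism_eqI)
    show "ratfun_endomorphism \<phi>" "ratfun_endomorphism \<Psi>"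
      using that \<open>P \<Psi>\<close> by (simp_all add: P_def ratfun_automorphism_iff)
    show "\<phi> (to_fract (lmonom m)) = \<Psi> (to_fract (lmonom m))" for m
      using that \<open>P \<Psi>\<close> unfolding P_def zmonom_eq_lmonom[symmetric] by simp
  qed
  ultimately have "P (THE \<phi>. P \<phi>)"
    by (rule theI)
  then have "P (mut_ratfun v)"
    unfolding mut_ratfun_def P_def .
  then show "ratfun_automorphism (mut_ratfun v)"
    "mut_ratfun v (to_fract (zmonom w)) =
      to_fract (zmonom w) * to_fract (1 + zmonom (perp v)) powi (- dot v w)"
    unfolding P_def to_fract_add to_fract_1 by blast+
qed

lemma to_fract_lmonom_uminus: "to_fract (lmonom (\<lambda>j. - m j)) = inverse (to_fract (lmonom m))"
proof (rule inverse_unique[symmetric])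
  have "lmonom m * lmonom (\<lambda>j. - m j) = 1"
    unfolding lmonom_add[symmetric] by simp
  then show "to_fract (lmonom m) * to_fract (lmonom (\<lambda>j. - m j)) = 1"
    unfolding to_fract_mult[symmetric] by simp
qed

lemma to_fract_lmonom_scale: "to_fract (lmonom (\<lambda>j. k * m j)) = to_fract (lmonom m) powi k"
proof (induction k rule: int_induct[where k = 0])
  case (step1 k)
  have "to_fract (lmonom (\<lambda>j. (k + 1) * m j)) = to_fract (lmonom (\<lambda>j. k * m j)) * to_fract (lmonom m)"
    unfolding to_fract_mult[symmetric] lmonom_add[symmetric] by (simp add: algebra_simps)
  then show ?case using step1 by (simp add: power_int_add)
next
  case (step2 k)
  have "to_fract (lmonom (\<lambda>j. k * m j)) = to_fract (lmonom (\<lambda>j. (k - 1) * m j)) * to_fract (lmonom m)"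
    unfolding to_fract_mult[symmetric] lmonom_add[symmetric] by (simp add: algebra_simps)
  then show ?case using step2 by (simp add: power_int_diff eq_divide_eq)
qed simp

lemma to_fract_lmonom: "to_fract (lmonom m) = (\<Prod>j\<in>UNIV. ratvar j powi m j)"
proof -
  have "to_fract (lmonom (\<lambda>k. if k \<in> S then m k else 0)) = (\<Prod>j\<in>S. ratvar j powi m j)" for S
  proof (induction S rule: infinite_finite_induct)
    case (insert x S)
    have split: "(\<lambda>k. if k \<in> insert x S then m k else 0) =
        (\<lambda>k. m x * (if k = x then 1 else 0) + (if k \<in> S then m k else 0))"
      using insert by auto
    show ?case
      unfolding split lmonom_add to_fract_mult to_fract_lmonom_scale
      using insert by (simp add: ratvar_def)
  qed simp_all
  from this[of UNIV] show ?thesis by simp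
qed

text \<open>
  Since \<open>B i i = 0\<close>, the exchange binomial does not involve the variable with index \<open>i\<close> and is fixed by
  the substitution.
\<close>
lemma
  fixes B :: "'n::{finite,linorder} \<Rightarrow> 'n \<Rightarrow> int"
  assumes "B i i = 0"
  defines "u \<equiv> lmonom (\<lambda>j. pos_part (B i j)) + lmonom (\<lambda>j. pos_part (- B i j))"
  shows ratfun_automorphism_cluster_mutation: "ratfun_automorphism (cluster_mutation B i)"
    and cluster_mutation_lmonom: "cluster_mutation B i (to_fract (lmonom m)) =
      to_fract (lmonom (\<lambda>j. if j = i then - m i else m j)) * to_fract u powi m i"
proof -
  define P where "P \<phi> \<longleftrightarrow> ratfun_automorphism \<phi> \<and>
     (\<forall>j. j \<noteq> i \<longrightarrow> \<phi> (ratvar j) = ratvar j) \<and>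
     \<phi> (ratvar i) = inverse (ratvar i) * (\<Prod>j\<in>UNIV. ratvar j powi pos_part (B i j)) *
       (1 + (\<Prod>j\<in>UNIV. ratvar j powi (- B i j)))" for \<phi>
  define A where "A m = (\<lambda>j. if j = i then - m i else m j)" for m :: "'n \<Rightarrow> int"
  interpret monomial_twist A "\<lambda>m. m i" u
    unfolding u_def A_def
  proof
    fix e
    assume "e \<in> Poly_Mapping.keys
      (lmonom (\<lambda>j. pos_part (B i j)) + lmonom (\<lambda>j. pos_part (- B i j)))"
    then have "Poly_Mapping.lookup e i = 0"
      by (elim keys_lmonom_add_lmonom[THEN disjE]) (simp_all add: assms(1) pos_part_def)
    then show "Poly_Mapping.lookup e i = 0"
      and "(\<lambda>j. if j = i then - Poly_Mapping.lookup e i else Poly_Mapping.lookup e j) =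
        Poly_Mapping.lookup e"
      by auto
  qed (auto simp: lmonom_add_lmonom_nonzero)
  obtain \<Psi> where \<Psi>: "ratfun_automorphism \<Psi>"
    "\<And>m. \<Psi> (to_fract (lmonom m)) = twisted_monomial A u (\<lambda>m. m i) m"
    using twist_automorphism by blast
  have "\<Psi> (ratvar j) = ratvar j" if "j \<noteq> i" for j
  proof -
    have "A (\<lambda>k. if k = j then 1 else 0) = (\<lambda>k. if k = j then 1 else 0)"
      using that by (auto simp: A_def)
    then show ?thesis
      using that by (simp add: ratvar_def \<Psi>(2) twisted_monomial_def)
  qed
  moreover have "\<Psi> (ratvar i) = inverse (ratvar i) *
      (\<Prod>j\<in>UNIV. ratvar j powi pos_part (B i j)) * (1 + (\<Prod>j\<in>UNIV. ratvar j powi (- B i j)))"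
  proof -
    have "A (\<lambda>k. if k = i then 1 else 0) = (\<lambda>k. - (if k = i then 1 else 0))"
      by (auto simp: A_def)
    then have "\<Psi> (ratvar i) = inverse (ratvar i) * to_fract u"
      by (simp add: ratvar_def \<Psi>(2) twisted_monomial_def to_fract_lmonom_uminus)
    moreover have "lmonom (\<lambda>j. pos_part (B i j)) * (1 + lmonom (\<lambda>j. - B i j)) = u"
    proof -
      have "pos_part (- b) = pos_part b + (- b)" for b
        by (simp add: pos_part_def)
      then show ?thesis
        unfolding u_def by (simp only: lmonom_add) (simp add: distrib_left)
    qed
    ultimately show ?thesis
      by (simp add: mult.assoc flip: to_fract_lmonom to_fract_mult to_fract_add to_fract_1)
  qed
  ultimately have "P \<Psi>"
    using \<Psi>(1) by (simp add: P_def)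
  moreover have "\<phi> = \<Psi>" if "P \<phi>" for \<phi>
  proof (rule ratfun_endomorphism_eqI)
    show endo: "ratfun_endomorphism \<phi>" "ratfun_endomorphism \<Psi>"
      using that \<open>P \<Psi>\<close> by (simp_all add: P_def ratfun_automorphism_iff)
    have "\<phi> (ratvar j) = \<Psi> (ratvar j)" for j
      using that \<open>P \<Psi>\<close> by (cases "j = i") (simp_all add: P_def)
    then show "\<phi> (to_fract (lmonom m)) = \<Psi> (to_fract (lmonom m))" for m
      by (simp add: to_fract_lmonom endo ratfun_endomorphism_prod ratfun_endomorphism_powi)
  qed
  ultimately have "(THE \<phi>. P \<phi>) = \<Psi>"
    by (rule the_equality)
  then have "cluster_mutation B i = \<Psi>"
    unfolding cluster_mutation_def P_def .
  then show "ratfun_automorphism (cluster_mutation B i)"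
    "cluster_mutation B i (to_fract (lmonom m)) =
      to_fract (lmonom (\<lambda>j. if j = i then - m i else m j)) * to_fract u powi m i"
    using \<Psi> by (simp_all add: twisted_monomial_def A_def)
qed


section \<open>The comparison map\<close>

lemma
  fixes s :: "'n::{finite,linorder} seed"
  shows laurent_hom_comparison_map: "laurent_hom (\<lambda>f. to_fract (comparison_map s f))"
    and comparison_map_zmonom:
      "comparison_map s (zmonom w) = lmonom (\<lambda>j. - dot w (directions s j))"
proof -
  define M where "M m = to_fract (lmonom (\<lambda>j. - dot (m 0, m 1) (directions s j)))"
    for m :: "2 \<Rightarrow> int"
  have eq: "(\<lambda>f. to_fract (comparison_map s f)) = monomial_lift M"
    by (simp add: comparison_map_def monomial_lift_def M_def fun_eq_iff)
  have M: "M (\<lambda>_. 0) = 1" "M (\<lambda>j. a j + b j) = M a * M b" for a b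
  proof -
    show "M (\<lambda>_. 0) = 1"
      by (simp add: M_def dot_def)
    have "(\<lambda>j. - dot (a 0 + b 0, a 1 + b 1) (directions s j)) =
        (\<lambda>j. - dot (a 0, a 1) (directions s j) + - dot (b 0, b 1) (directions s j))"
      by (simp add: fun_eq_iff dot_def algebra_simps)
    then show "M (\<lambda>j. a j + b j) = M a * M b"
      by (simp only: M_def lmonom_add to_fract_mult)
  qed
  show "laurent_hom (\<lambda>f. to_fract (comparison_map s f))"
    unfolding eq by (rule laurent_hom_monomial_lift[OF M])
  show "comparison_map s (zmonom w) = lmonom (\<lambda>j. - dot w (directions s j))"
    using fun_cong[OF eq, of "zmonom w"]
      monomial_lift_lmonom[of M "\<lambda>k. if k = 0 then fst w else snd w", OF M]
    by (simp add: zmonom_def M_def)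
qed

text \<open>The value on a fraction does not depend on how the fraction is written.\<close>
lemma comparison_map_loc_fraction:
  fixes s :: "'n::{finite,linorder} seed"
  assumes d: "d \<noteq> 0" and \<Phi>d: "comparison_map s d \<noteq> 0"
  shows "comparison_map_loc s d (to_fract p / to_fract d ^ k) =
    to_fract (comparison_map s p) / to_fract (comparison_map s d) ^ k"
  unfolding comparison_map_loc_def
proof (rule the_equality)
  fix y
  let ?\<Phi> = "\<lambda>f. to_fract (comparison_map s f)"
  assume "\<exists>q l. to_fract p / to_fract d ^ k = to_fract q / to_fract d ^ l \<and> y = ?\<Phi> q / ?\<Phi> d ^ l"
  then obtain q l where q: "to_fract p / to_fract d ^ k = to_fract q / to_fract d ^ l"
    and y: "y = ?\<Phi> q / ?\<Phi> d ^ l"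
    by blast
  have pow: "to_fract (d ^ n) = to_fract d ^ n" for n
    by (rule laurent_hom_power) (rule laurent_hom_to_fract)
  have "to_fract (p * d ^ l) = to_fract (q * d ^ k)"
    using q d by (simp add: pow frac_eq_eq)
  then have "p * d ^ l = q * d ^ k"
    by (simp only: to_fract_eq_iff)
  then have "?\<Phi> (p * d ^ l) = ?\<Phi> (q * d ^ k)"
    by simp
  then have "?\<Phi> p * ?\<Phi> d ^ l = ?\<Phi> q * ?\<Phi> d ^ k"
    by (simp only: laurent_hom_simps[OF laurent_hom_comparison_map])
  then show "y = ?\<Phi> p / ?\<Phi> d ^ k"
    using \<Phi>d by (simp add: y frac_eq_eq)
qed blast


section \<open>Compatibility with mutation\<close>

text \<open>
  The bracket with \<open>v = directions s i\<close> is unchanged by mutation, because mutation moves every other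
  direction by a multiple of \<open>v\<close>, and \<open>v\<close> itself to \<open>-v\<close>, whose bracket with \<open>v\<close> is \<open>0\<close> as well.
\<close>
lemma comparison_map_mutate_seed_binomial:
  fixes s :: "'n::{finite,linorder} seed"
  shows "comparison_map (mutate_seed i s) (1 + zmonom (perp (directions s i))) =
    1 + lmonom (exchange_matrix s i)"
proof -
  let ?s' = "mutate_seed i s" and ?v = "directions s i"
  have "- dot (perp ?v) (directions ?s' j) = exchange_matrix s i j" for j
    by (simp add: mutate_seed_def exchange_matrix_def dot_def perp_def bracket_def mut_vec_def
        algebra_simps)
  then have "comparison_map ?s' (zmonom (perp ?v)) = lmonom (exchange_matrix s i)"
    by (simp add: comparison_map_zmonom)
  then have "to_fract (comparison_map ?s' (1 + zmonom (perp ?v))) =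
      to_fract (1 + lmonom (exchange_matrix s i))"
    by (simp add: laurent_hom_simps[OF laurent_hom_comparison_map])
  then show ?thesis by (simp only: to_fract_eq_iff)
qed

text \<open>
  The heart of the matter. With the exchange binomial written as \<open>x\<^bsup>[-b]+\<^esup> (1 + x\<^sup>b)\<close>, its monomial factor
  turns the exponents \<open>- dot w v\<^sub>j\<close> into those for the mutated directions \<open>v\<^sub>j + [-b\<^sub>j]\<^sub>+ v\<close>, and the
  inversion of the variable with index \<open>i\<close> corresponds to \<open>v \<mapsto> -v\<close>.
\<close>
lemma cluster_mutation_comparison_map_zmonom:
  fixes s :: "'n::{finite,linorder} seed" and i :: 'n
  defines "v \<equiv> directions s i" and "B \<equiv> exchange_matrix s"
  shows "cluster_mutation B i (to_fract (comparison_map s (zmonom w))) =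
    to_fract (comparison_map (mutate_seed i s) (zmonom w)) *
      to_fract (1 + lmonom (B i)) powi (- dot v w)"
proof -
  let ?neg = "\<lambda>j. pos_part (- B i j)" and ?e = "\<lambda>j. - dot w (directions s j)"
  have Bii: "B i i = 0"
    by (simp add: B_def exchange_matrix_def bracket_def)
  have "(\<lambda>j. pos_part (B i j)) = (\<lambda>j. ?neg j + B i j)"
    by (auto simp: fun_eq_iff pos_part_def max_def)
  then have "lmonom (\<lambda>j. pos_part (B i j)) = lmonom ?neg * lmonom (B i)"
    by (simp only: lmonom_add)
  then have binomial: "lmonom (\<lambda>j. pos_part (B i j)) + lmonom ?neg =
      lmonom ?neg * (1 + lmonom (B i))"
    by (simp add: distrib_left)
  have exponents: "(\<lambda>j. if j = i then - ?e i else ?e j + (- dot v w) * ?neg j) =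
      (\<lambda>j. - dot w (directions (mutate_seed i s) j))"
    by (auto simp: fun_eq_iff mutate_seed_def mut_vec_def dot_def v_def B_def exchange_matrix_def
        bracket_def algebra_simps)
  \<comment> \<open>At \<open>j = i\<close> the correction vanishes because \<open>B i i = 0\<close>.\<close>
  have "(\<lambda>j. if j = i then - ?e i else ?e j + (- dot v w) * ?neg j) =
      (\<lambda>j. (if j = i then - ?e i else ?e j) + (- dot v w) * ?neg j)"
    using Bii by (auto simp: fun_eq_iff pos_part_def)
  then have split: "to_fract (comparison_map (mutate_seed i s) (zmonom w)) =
      to_fract (lmonom (\<lambda>j. if j = i then - ?e i else ?e j)) *
        to_fract (lmonom ?neg) powi (- dot v w)"
    unfolding comparison_map_zmonom exponents[symmetric]
    by (simp only: lmonom_add to_fract_mult to_fract_lmonom_scale)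
  have "?e i = - dot v w"
    by (simp add: v_def dot_def mult.commute)
  then show ?thesis
    unfolding split unfolding comparison_map_zmonom cluster_mutation_lmonom[of B, OF Bii] binomial
    by (simp only: to_fract_mult power_int_mult_distrib mult.assoc)
qed

theorem lemma3p2:
  fixes s :: "'n::{finite,linorder} seed" and i :: 'n
  assumes "LG_seed s"
  shows "cluster_mutation (exchange_matrix s) i \<circ> (to_fract \<circ> comparison_map s) =
    comparison_map_loc (mutate_seed i s) (1 + zmonom (perp (directions s i))) \<circ>
      (mut_ratfun (directions s i) \<circ> to_fract)"
proof
  fix f
  define v where "v = directions s i"
  define d where "d = 1 + zmonom (perp v)"
  define C where "C = cluster_mutation (exchange_matrix s) i"
  define \<Phi>' where "\<Phi>' = comparison_map (mutate_seed i s)"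
  have \<Phi>'d: "\<Phi>' d = 1 + lmonom (exchange_matrix s i)"
    unfolding \<Phi>'_def d_def v_def by (rule comparison_map_mutate_seed_binomial)
  have d_nz: "d \<noteq> 0"
    unfolding d_def by (rule one_plus_zmonom_nonzero)
  have \<Phi>'d_nz: "\<Phi>' d \<noteq> 0"
    using lmonom_add_lmonom_nonzero[of "\<lambda>_. 0" "exchange_matrix s i"] by (simp add: \<Phi>'d)
  have "exchange_matrix s i i = 0"
    by (simp add: exchange_matrix_def bracket_def)
  then have "ratfun_endomorphism C"
    unfolding C_def using ratfun_automorphism_cluster_mutation ratfun_automorphism_iff by blast
  then have lhs_hom: "laurent_hom (\<lambda>f. C (to_fract (comparison_map s f)))"
    by (rule laurent_hom_endomorphism_comp) (rule laurent_hom_comparison_map)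
  have rhs_hom: "laurent_hom (\<lambda>f. to_fract (\<Phi>' f))"
    unfolding \<Phi>'_def by (rule laurent_hom_comparison_map)
  have "ratfun_endomorphism (mut_ratfun v)"
    using ratfun_automorphism_mut_ratfun ratfun_automorphism_iff by blast
  then have mut_hom: "laurent_hom (\<lambda>f. mut_ratfun v (to_fract f))"
    by (rule laurent_hom_endomorphism_comp) (rule laurent_hom_to_fract)
  have monomials: "\<exists>q l. mut_ratfun v (to_fract (lmonom m)) = to_fract q * to_fract d powi l \<and>
      C (to_fract (comparison_map s (lmonom m))) = to_fract (\<Phi>' q) * to_fract (\<Phi>' d) powi l"
    for m
  proof (intro exI conjI)
    show "mut_ratfun v (to_fract (lmonom m)) =
        to_fract (lmonom m) * to_fract d powi (- dot v (m 0, m 1))"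
      using mut_ratfun_zmonom[of v "(m 0, m 1)"] by (simp only: zmonom_eq_lmonom d_def)
    show "C (to_fract (comparison_map s (lmonom m))) =
        to_fract (\<Phi>' (lmonom m)) * to_fract (\<Phi>' d) powi (- dot v (m 0, m 1))"
      using cluster_mutation_comparison_map_zmonom[of s i "(m 0, m 1)"]
      unfolding zmonom_eq_lmonom C_def \<Phi>'d unfolding \<Phi>'_def v_def .
  qed
  have nz: "to_fract d \<noteq> 0" "to_fract (\<Phi>' d) \<noteq> 0"
    using d_nz \<Phi>'d_nz by simp_all
  \<comment> \<open>One fraction \<open>p / d ^ k\<close> for the mutation of \<open>f\<close>, whose image under the localized comparison map
    is the left-hand side of the claim at \<open>f\<close>.\<close>
  obtain p k where "mut_ratfun v (to_fract f) * to_fract d ^ k = to_fract p"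
    and "C (to_fract (comparison_map s f)) * to_fract (\<Phi>' d) ^ k = to_fract (\<Phi>' p)"
    by (rule common_numerator[OF laurent_hom_to_fract rhs_hom mut_hom lhs_hom nz monomials])
  then have mut_f: "mut_ratfun v (to_fract f) = to_fract p / to_fract d ^ k"
    and C_f: "C (to_fract (comparison_map s f)) = to_fract (\<Phi>' p) / to_fract (\<Phi>' d) ^ k"
    using nz by (simp_all add: eq_divide_eq)
  have "C (to_fract (comparison_map s f)) =
      comparison_map_loc (mutate_seed i s) d (mut_ratfun v (to_fract f))"
    unfolding mut_f C_f \<Phi>'_def
    by (rule comparison_map_loc_fraction[OF d_nz \<Phi>'d_nz[unfolded \<Phi>'_def], symmetric])
  then show "(cluster_mutation (exchange_matrix s) i \<circ> (to_fract \<circ> comparison_map s)) f =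
    (comparison_map_loc (mutate_seed i s) (1 + zmonom (perp (directions s i))) \<circ>
      (mut_ratfun (directions s i) \<circ> to_fract)) f"
    by (simp only: o_apply C_def d_def v_def)
qed

end
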